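(* Let $a$ be an odd positive integer and $m$ a nonnegative integer. For every positive integer $n$: if $n\equiv \frac{a-1}2+m\pmod 2$ then $$t(a,3a,8m+4;n)=\frac 23N(a,3a,8m+4;8n+4a+8m+4),$$ and if $n\not\equiv \frac{a-1}2+m\pmod 2$ then $$t(a,3a,8m+4;n)=\frac 23\big(N(a,3a,8m+4;8n+4a+8m+4)-N(a,3a,8m+4;2n+a+2m+1)\big).$$
   Context: For positive integers $a_1,\dots,a_k$ and a nonnegative integer $n$, $N(a_1,\dots,a_k;n)$ is the number of $(x_1,\dots,x_k)\in\mathbb Z^k$ with $n=a_1x_1^2+\cdots+a_kx_k^2$, and $t(a_1,\dots,a_k;n)$ is the number of $(x_1,\dots,x_k)\in\mathbb Z^k$ with $n=a_1\frac{x_1(x_1-1)}2+\cdots+a_k\frac{x_k(x_k-1)}2$. *)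

theory Defs
  imports Complex_Main "HOL-Number_Theory.Cong"
begin

text \<open>The coefficients \<open>(a\<^sub>1, \<dots>, a\<^sub>k)\<close> are given as a list, and a vector of \<open>\<int>\<^sup>k\<close> is an integer list
  of length \<open>k\<close>. Both solution sets are finite when all coefficients are positive.\<close>

definition N :: "nat list \<Rightarrow> nat \<Rightarrow> nat" where
  "N as n = card {xs :: int list. length xs = length as \<and>
     int n = (\<Sum>i<length as. int (as ! i) * (xs ! i)\<^sup>2)}"

text \<open>Since \<open>x (x - 1)\<close> is even, the integer division below is exact.\<close>

definition t :: "nat list \<Rightarrow> nat \<Rightarrow> nat" where
  "t as n = card {xs :: int list. length xs = length as \<and>
     int n = (\<Sum>i<length as. int (as ! i) * (xs ! i * (xs ! i - 1) div 2))}"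

end

theory Submission
  imports Defs
begin

text \<open>
  Put \<open>K = 2n + a + 2m + 1\<close>. Completing squares, \<open>t(a, 3a, 8m+4; n)\<close> counts the solutions of
  \<open>a x\<^sup>2 + 3 a y\<^sup>2 + (8m+4) z\<^sup>2 = 4 K\<close> with \<open>x, y, z\<close> all odd. In any other solution \<open>x\<close> and \<open>y\<close> are
  even; those with \<open>z\<close> even are, after halving, the solutions for \<open>K\<close>, and those with \<open>z\<close> odd are
  half as numerous as the odd ones, because multiplication of \<open>x + y \<surd>-3\<close> by the sixth roots of
  unity carries \<open>(2u, 2v)\<close> with \<open>u + v\<close> odd to \<open>(u + 3v, \<plusminus>(u - v))\<close>. Finally, if
  \<open>n \<equiv> (a-1)/2 + m\<close> modulo 2 then \<open>K \<equiv> 2\<close> modulo 4, and there are no solutions for \<open>K\<close>.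
\<close>

section \<open>Ternary diagonal quadratic forms\<close>

definition reps :: "int \<Rightarrow> int \<Rightarrow> int \<Rightarrow> int \<Rightarrow> (int \<times> int \<times> int) set" where
  "reps a b c k = {(x, y, z). a * x\<^sup>2 + b * y\<^sup>2 + c * z\<^sup>2 = k}"

lemma finite_reps:
  assumes "a > 0" "b > 0" "c > 0"
  shows "finite (reps a b c k)"
proof -
  \<comment> \<open>Integers satisfy |x| \<le> x^2, so each variable is bounded as soon as the other
    two terms are gathered into \<open>r\<close>.\<close>
  have bound: "x \<in> {-k..k}" if "p * x\<^sup>2 + r = k" "p > 0" "r \<ge> 0" for p x r :: int
  proof -
    have "\<bar>x\<bar> \<le> x\<^sup>2"
      using self_le_power[of "\<bar>x\<bar>" 2] by (cases "x = 0") auto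
    moreover have "x\<^sup>2 \<le> p * x\<^sup>2"
      using that mult_right_mono[of 1 p "x\<^sup>2"] by simp
    ultimately show ?thesis using that by auto
  qed
  have "reps a b c k \<subseteq> {-k..k} \<times> {-k..k} \<times> {-k..k}"
  proof (intro subsetI, unfold split_paired_all)
    fix x y z assume "(x, y, z) \<in> reps a b c k"
    then have e: "a * x\<^sup>2 + b * y\<^sup>2 + c * z\<^sup>2 = k" by (simp add: reps_def)
    have "a * x\<^sup>2 \<ge> 0" "b * y\<^sup>2 \<ge> 0" "c * z\<^sup>2 \<ge> 0" using assms by simp_all
    then show "(x, y, z) \<in> {-k..k} \<times> {-k..k} \<times> {-k..k}"
      using bound[of a x "b * y\<^sup>2 + c * z\<^sup>2"] bound[of b y "a * x\<^sup>2 + c * z\<^sup>2"]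
        bound[of c z "a * x\<^sup>2 + b * y\<^sup>2"] e assms by (simp add: algebra_simps)
  qed
  then show ?thesis by (rule finite_subset) simp
qed

lemma length_3_ex: "length xs = Suc (Suc (Suc 0)) \<Longrightarrow> \<exists>x y z. xs = [x, y, z]"
  by (auto simp: length_Suc_conv)

lemma N_eq_card_reps: "N [a, b, c] n = card (reps (int a) (int b) (int c) (int n))"
proof -
  have "bij_betw (\<lambda>(x, y, z). [x, y, z]) (reps (int a) (int b) (int c) (int n))
     {xs :: int list. length xs = length [a, b, c] \<and>
     int n = (\<Sum>i<length [a, b, c]. int ([a, b, c] ! i) * (xs ! i)\<^sup>2)}"
    by (rule bij_betw_byWitness[where f' = "\<lambda>xs. (xs ! 0, xs ! 1, xs ! 2)"])
      (auto simp: reps_def eval_nat_numeral dest!: length_3_ex)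
  then show ?thesis unfolding N_def by (rule bij_betw_same_card[symmetric])
qed

section \<open>Triangular numbers and odd squares\<close>

definition odd_reps :: "int \<Rightarrow> int \<Rightarrow> int \<Rightarrow> int \<Rightarrow> (int \<times> int \<times> int) set" where
  "odd_reps a b c k = {(x, y, z) \<in> reps a b c k. odd x \<and> odd y \<and> odd z}"

lemma odd_square_triangular:
  "(2 * x - 1)\<^sup>2 = 8 * (x * (x - 1) div 2) + (1 :: int)"
proof -
  have "2 * (x * (x - 1) div 2) = x * (x - 1)" by simp
  moreover have "(2 * x - 1)\<^sup>2 = 4 * (x * (x - 1)) + 1"
    by (simp add: power2_eq_square algebra_simps)
  ultimately show ?thesis by linarith
qed

text \<open>Multiply the equation by 8 and add a + b + c: each term becomes a coefficient times (2x
  - 1)^2, and x \<mapsto> 2x - 1 maps the integers bijectively onto the odd integers.\<close>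

lemma t_eq_card_odd_reps:
  "t [a, b, c] n = card (odd_reps (int a) (int b) (int c) (int (8 * n + a + b + c)))"
proof -
  let ?T = "{xs :: int list. length xs = length [a, b, c] \<and>
     int n = (\<Sum>i<length [a, b, c]. int ([a, b, c] ! i) * (xs ! i * (xs ! i - 1) div 2))}"
  let ?R = "odd_reps (int a) (int b) (int c) (int (8 * n + a + b + c))"
  have iff: "[x, y, z] \<in> ?T \<longleftrightarrow> (2 * x - 1, 2 * y - 1, 2 * z - 1) \<in> ?R" for x y z
    unfolding odd_reps_def reps_def mem_Collect_eq prod.case odd_square_triangular
    by (simp add: algebra_simps) (auto simp: algebra_simps)
  have "bij_betw (\<lambda>xs. (2 * xs ! 0 - 1, 2 * xs ! 1 - 1, 2 * xs ! 2 - 1)) ?T ?R"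
  proof (rule bij_betw_byWitness
      [where f' = "\<lambda>(x, y, z). [(x + 1) div 2, (y + 1) div 2, (z + 1) div 2]"])
    show "\<forall>xs\<in>?T. (case (2 * xs ! 0 - 1, 2 * xs ! 1 - 1, 2 * xs ! 2 - 1) of
        (x, y, z) \<Rightarrow> [(x + 1) div 2, (y + 1) div 2, (z + 1) div 2]) = xs"
      by (auto simp: eval_nat_numeral dest!: length_3_ex)
    show "\<forall>p\<in>?R. (\<lambda>xs. (2 * xs ! 0 - 1, 2 * xs ! 1 - 1, 2 * xs ! 2 - 1))
        (case p of (x, y, z) \<Rightarrow> [(x + 1) div 2, (y + 1) div 2, (z + 1) div 2]) = p"
      by (auto simp: odd_reps_def elim!: oddE)
    show "(\<lambda>xs. (2 * xs ! 0 - 1, 2 * xs ! 1 - 1, 2 * xs ! 2 - 1)) ` ?T \<subseteq> ?R"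
    proof (rule image_subsetI)
      fix xs assume xs: "xs \<in> ?T"
      then obtain x y z where "xs = [x, y, z]" using length_3_ex[of xs] by auto
      then show "(2 * xs ! 0 - 1, 2 * xs ! 1 - 1, 2 * xs ! 2 - 1) \<in> ?R"
        using xs iff[of x y z] by (simp del: mem_Collect_eq)
    qed
    show "(\<lambda>(x, y, z). [(x + 1) div 2, (y + 1) div 2, (z + 1) div 2]) ` ?R \<subseteq> ?T"
    proof (rule image_subsetI)
      fix p assume p: "p \<in> ?R"
      obtain x y z where p_eq: "p = (x, y, z)" by (cases p)
      with p have "odd x" "odd y" "odd z" by (auto simp: odd_reps_def)
      then have half: "2 * ((x + 1) div 2) - 1 = x" "2 * ((y + 1) div 2) - 1 = y"
        "2 * ((z + 1) div 2) - 1 = z" by presburger+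
      show "(case p of (x, y, z) \<Rightarrow> [(x + 1) div 2, (y + 1) div 2, (z + 1) div 2]) \<in> ?T"
        using p iff[of "(x + 1) div 2" "(y + 1) div 2" "(z + 1) div 2"]
        unfolding p_eq prod.case half by (rule iffD2[rotated])
    qed
  qed
  then show ?thesis unfolding t_def by (rule bij_betw_same_card)
qed

section \<open>Parity classes of the solutions for 4K\<close>

context
  fixes A D K :: int
  assumes A: "odd A" "A > 0" and D: "odd D" "D > 0" and K: "even K"
begin

lemma mem_reps_double:
  "(2 * u, 2 * v, z) \<in> reps A (3 * A) (4 * D) (4 * K) \<longleftrightarrow> A * (u\<^sup>2 + 3 * v\<^sup>2) + D * z\<^sup>2 = K"
  by (auto simp: reps_def power2_eq_square algebra_simps)

lemma same_parity:
  assumes "(x, y, z) \<in> reps A (3 * A) (4 * D) (4 * K)"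
  shows "even x \<longleftrightarrow> even y"
proof -
  from assms have "A * x\<^sup>2 + 3 * A * y\<^sup>2 = 4 * (K - D * z\<^sup>2)"
    by (simp add: reps_def algebra_simps)
  then have "even (A * x\<^sup>2 + 3 * A * y\<^sup>2)" by simp
  then show ?thesis using A by simp
qed

text \<open>For odd x and y, x^2 + 3y^2 is 4 modulo 8, because p(p + 1) and q(q + 1) are even.
  Division by 4 leaves an odd number plus D z^2 equal to the even K.\<close>

lemma odd_third:
  assumes "(x, y, z) \<in> reps A (3 * A) (4 * D) (4 * K)" "odd x" "odd y"
  shows "odd z"
proof -
  obtain p q where pq: "x = 2 * p + 1" "y = 2 * q + 1"
    using assms by (auto elim!: oddE)
  from assms(1) have "A * (p * (p + 1) + 3 * (q * (q + 1)) + 1) + D * z\<^sup>2 = K"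
    unfolding pq by (simp add: reps_def power2_eq_square algebra_simps)
  then have "even (A * (p * (p + 1) + 3 * (q * (q + 1)) + 1) + D * z\<^sup>2)" using K by simp
  then show ?thesis using A D by simp
qed

text \<open>For odd x and y exactly one of x - y and x + y is divisible by 4. The sign change of y
  swaps the two resulting halves of \<open>?T\<close>, and each half has the size of
  \<open>?P\<close>.\<close>

lemma card_odd_reps:
  "card (odd_reps A (3 * A) (4 * D) (4 * K))
    = 2 * card {(x, y, z) \<in> reps A (3 * A) (4 * D) (4 * K). even x \<and> even y \<and> odd z}"
  (is "card ?T = 2 * card ?P")
proof -
  define T1 where "T1 = {(x, y, z) \<in> ?T. 4 dvd x - y}"
  define T2 where "T2 = {(x, y, z) \<in> ?T. 4 dvd x + y}"
  have fin: "finite ?T"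
    unfolding odd_reps_def
    by (rule finite_subset[OF _ finite_reps[of A "3 * A" "4 * D" "4 * K"]]) (use A D in auto)
  have "?T = T1 \<union> T2"
  proof -
    have "4 dvd x - y \<or> 4 dvd x + y" if "odd x" "odd y" for x y :: int
      using that by presburger
    then show ?thesis by (auto simp: T1_def T2_def odd_reps_def)
  qed
  moreover have "T1 \<inter> T2 = {}"
  proof -
    have "\<not> (4 dvd x - y \<and> 4 dvd x + y)" if "odd x" for x y :: int
      using that by presburger
    then show ?thesis by (auto simp: T1_def T2_def odd_reps_def)
  qed
  moreover have "finite T1" "finite T2"
    using fin by (auto simp: T1_def T2_def intro: rev_finite_subset)
  ultimately have "card ?T = card T1 + card T2" by (simp add: card_Un_disjoint)
  moreover have "card T1 = card T2"
  proof (rule bij_betw_same_card)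
    show "bij_betw (\<lambda>(x, y, z). (x, - y, z)) T1 T2"
      by (rule bij_betw_byWitness[where f' = "\<lambda>(x, y, z). (x, - y, z)"])
        (auto simp: T1_def T2_def odd_reps_def reps_def)
  qed
  moreover have "card ?P = card T1"
  proof (rule bij_betw_same_card)
    \<comment> \<open>Multiplication of x + y sqrt(-3) by (1 - sqrt(-3))/2, a sixth root of unity,
      followed by conjugation; so x^2 + 3y^2 is preserved.\<close>
    let ?f = "\<lambda>(x, y, z). (x div 2 + 3 * (y div 2), x div 2 - y div 2, z)"
    \<comment> \<open>Solving x = u + 3v, y = u - v gives 4v = x - y and u = y + v, which is
      integral exactly under the condition defining \<open>T1\<close>.\<close>
    let ?g = "\<lambda>(x, y, z). (2 * (y + (x - y) div 4), 2 * ((x - y) div 4), z)"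
    show "bij_betw ?f ?P T1"
    proof (rule bij_betw_byWitness[where f' = ?g])
      show "\<forall>p\<in>?P. ?g (?f p) = p"
        by (auto elim!: evenE)
      show "\<forall>p\<in>T1. ?f (?g p) = p"
        by (auto simp: T1_def elim!: dvdE)
      show "?f ` ?P \<subseteq> T1"
      proof (clarify)
        fix x y z assume r: "(x, y, z) \<in> reps A (3 * A) (4 * D) (4 * K)"
          and xy: "even x" "even y" and z: "odd z"
        then obtain u v where uv: "x = 2 * u" "y = 2 * v" by (auto elim!: evenE)
        have e: "A * (u\<^sup>2 + 3 * v\<^sup>2) + D * z\<^sup>2 = K"
          using r unfolding uv mem_reps_double .
        then have "even (A * (u\<^sup>2 + 3 * v\<^sup>2) + D * z\<^sup>2)" using K by simp
        \<comment> \<open>With A, D, z odd and K even, u^2 + 3v^2 must be odd. This is what makes u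
          + 3v and u - v odd.\<close>
        then have "odd (u + v)" using A D z by simp
        moreover have "(u + 3 * v, u - v, z) \<in> reps A (3 * A) (4 * D) (4 * K)"
          using e by (auto simp: reps_def power2_eq_square algebra_simps)
        moreover have "4 dvd (u + 3 * v) - (u - v)" by simp
        ultimately show "(x div 2 + 3 * (y div 2), x div 2 - y div 2, z) \<in> T1"
          using z by (simp add: T1_def odd_reps_def uv)
      qed
      show "?g ` T1 \<subseteq> ?P"
      proof (clarify)
        fix x y z assume "(x, y, z) \<in> T1"
        then have r: "(x, y, z) \<in> reps A (3 * A) (4 * D) (4 * K)" and z: "odd z" and "4 dvd x - y"
          by (auto simp: T1_def odd_reps_def)
        then obtain v where "x - y = 4 * v" by (auto elim: dvdE)
        then have v: "x = y + 4 * v" by simp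
        from r have "(2 * (y + v), 2 * v, z) \<in> reps A (3 * A) (4 * D) (4 * K)"
          unfolding v by (simp add: reps_def power2_eq_square algebra_simps)
        then show "(2 * (y + (x - y) div 4), 2 * ((x - y) div 4), z) \<in> reps A (3 * A) (4 * D) (4 * K) \<and>
            even (2 * (y + (x - y) div 4)) \<and> even (2 * ((x - y) div 4)) \<and> odd z"
          using z by (simp add: v)
      qed
    qed
  qed
  ultimately show ?thesis by simp
qed

lemma card_even_reps:
  "card {(x, y, z) \<in> reps A (3 * A) (4 * D) (4 * K). even x \<and> even y \<and> even z}
    = card (reps A (3 * A) (4 * D) K)"
proof (rule bij_betw_same_card)
  show "bij_betw (\<lambda>(x, y, z). (x div 2, y div 2, z div 2))
      {(x, y, z) \<in> reps A (3 * A) (4 * D) (4 * K). even x \<and> even y \<and> even z}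
      (reps A (3 * A) (4 * D) K)"
    by (rule bij_betw_byWitness[where f' = "\<lambda>(x, y, z). (2 * x, 2 * y, 2 * z)"])
      (auto simp: reps_def power_mult_distrib elim!: evenE)
qed

text \<open>The solutions split into \<open>?T\<close>, \<open>?P\<close> and \<open>?Q\<close>, and
  \<open>?T\<close> is twice as large as \<open>?P\<close>. Doubling the count keeps the identity in
  the natural numbers, without fractions or subtraction.\<close>

lemma card_reps_quadruple:
  "2 * card (reps A (3 * A) (4 * D) (4 * K))
    = 3 * card (odd_reps A (3 * A) (4 * D) (4 * K)) + 2 * card (reps A (3 * A) (4 * D) K)"
proof -
  let ?S = "reps A (3 * A) (4 * D) (4 * K)"
  let ?T = "odd_reps A (3 * A) (4 * D) (4 * K)"
  let ?P = "{(x, y, z) \<in> ?S. even x \<and> even y \<and> odd z}"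
  let ?Q = "{(x, y, z) \<in> ?S. even x \<and> even y \<and> even z}"
  have fin: "finite ?S" using A D by (intro finite_reps) auto
  then have fins: "finite ?T" "finite ?P" "finite ?Q"
    by (auto simp: odd_reps_def intro: rev_finite_subset)
  have "?S = ?T \<union> (?P \<union> ?Q)"
    using same_parity odd_third by (auto simp: odd_reps_def)
  then have "card ?S = card (?T \<union> (?P \<union> ?Q))" by (rule arg_cong)
  also have "\<dots> = card ?T + card (?P \<union> ?Q)"
    using fins by (intro card_Un_disjoint) (auto simp: odd_reps_def)
  also have "card (?P \<union> ?Q) = card ?P + card ?Q"
    using fins by (intro card_Un_disjoint) auto
  finally have "card ?S = card ?T + (card ?P + card ?Q)" .
  then show ?thesis using card_odd_reps card_even_reps by simp
qed

text \<open>Modulo 2, x and y agree, and then x^2 + 3y^2 is a multiple of 4: it equals 4(y^2 + yd +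
  d^2) for x = y + 2d. So every solution would make K a multiple of 4.\<close>

lemma reps_empty:
  assumes "\<not> 4 dvd K"
  shows "reps A (3 * A) (4 * D) K = {}"
proof -
  have False if "(x, y, z) \<in> reps A (3 * A) (4 * D) K" for x y z
  proof -
    from that have e: "A * (x\<^sup>2 + 3 * y\<^sup>2) + 4 * (D * z\<^sup>2) = K"
      by (simp add: reps_def algebra_simps)
    then have "even (A * (x\<^sup>2 + 3 * y\<^sup>2) + 4 * (D * z\<^sup>2))" using K by simp
    then have "even (x - y)" using A by simp
    then obtain d where "x - y = 2 * d" by (rule evenE)
    then have d: "x = y + 2 * d" by simp
    have "K = 4 * (A * (y\<^sup>2 + y * d + d\<^sup>2) + D * z\<^sup>2)"
      unfolding e[symmetric] d by (simp add: power2_eq_square algebra_simps)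
    with assms show False by simp
  qed
  then show ?thesis by auto
qed

end

section \<open>The two congruence cases\<close>

theorem theorem3p3:
  fixes a m n :: nat
  assumes "odd a" and "n > 0"
  shows "([n = (a - 1) div 2 + m] (mod 2) \<longrightarrow>
      real (t [a, 3 * a, 8 * m + 4] n)
        = 2 / 3 * real (N [a, 3 * a, 8 * m + 4] (8 * n + 4 * a + 8 * m + 4)))
    \<and> (\<not> [n = (a - 1) div 2 + m] (mod 2) \<longrightarrow>
      real (t [a, 3 * a, 8 * m + 4] n)
        = 2 / 3 * (real (N [a, 3 * a, 8 * m + 4] (8 * n + 4 * a + 8 * m + 4))
                 - real (N [a, 3 * a, 8 * m + 4] (2 * n + a + 2 * m + 1))))"
proof -
  \<comment> \<open>The last coefficient is 4D with D odd, and both the argument of N and the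
    shifted argument coming from t equal 4K.\<close>
  define A D K where "A = int a" and "D = int (2 * m + 1)" and "K = int (2 * n + a + 2 * m + 1)"
  have A: "odd A" "A > 0" and D: "odd D" "D > 0" and K: "even K"
    using assms(1) by (auto simp: A_def D_def K_def elim: oddE)
  have coeffs: "int (3 * a) = 3 * A" "int (8 * m + 4) = 4 * D"
    "int (8 * n + 4 * a + 8 * m + 4) = 4 * K" "int (8 * n + a + 3 * a + (8 * m + 4)) = 4 * K"
    by (simp_all add: A_def D_def K_def)
  have t: "t [a, 3 * a, 8 * m + 4] n = card (odd_reps A (3 * A) (4 * D) (4 * K))"
    unfolding t_eq_card_odd_reps coeffs by (simp add: A_def)
  have N4: "N [a, 3 * a, 8 * m + 4] (8 * n + 4 * a + 8 * m + 4)
      = card (reps A (3 * A) (4 * D) (4 * K))"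
    unfolding N_eq_card_reps coeffs by (simp add: A_def)
  have N1: "N [a, 3 * a, 8 * m + 4] (2 * n + a + 2 * m + 1) = card (reps A (3 * A) (4 * D) K)"
    unfolding N_eq_card_reps coeffs by (simp add: A_def K_def)
  have main: "2 * real (card (reps A (3 * A) (4 * D) (4 * K)))
    = 3 * real (card (odd_reps A (3 * A) (4 * D) (4 * K)))
      + 2 * real (card (reps A (3 * A) (4 * D) K))"
    using arg_cong[OF card_reps_quadruple[OF A D K], of real] by simp
  \<comment> \<open>\<open>main\<close> holds in either case; the congruence only makes its last
    term vanish. With a = 2b + 1, K = 2(n + b + m + 1), and the bracket is odd when n \<equiv> b + m
    modulo 2.\<close>
  have "reps A (3 * A) (4 * D) K = {}" if "[n = (a - 1) div 2 + m] (mod 2)"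
  proof (rule reps_empty[OF A D K])
    obtain b where b: "a = 2 * b + 1" using assms(1) by (auto elim: oddE)
    have "n mod 2 = (b + m) mod 2" using that by (simp add: b cong_def)
    then have "\<not> 4 dvd 2 * n + a + 2 * m + 1" unfolding b by presburger
    then show "\<not> 4 dvd K" unfolding K_def by presburger
  qed
  then show ?thesis unfolding t N4 N1 using main by auto
qed

end
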